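(* Let $\mathbf{ftm}$ be the Fibonacci-Thue-Morse sequence, let $\rho(n)$ denote the number of distinct length-$n$ contiguous blocks (factors) of $\mathbf{ftm}$, and let $d(n) = \rho(n+1) - \rho(n)$ for $n \ge 0$. Then for every integer $m \geq 2$: \begin{align*} d(n) &= 8 \text{ for } F_{2m+1} + 2 \leq n \leq F_{2m+1} + F_{2m-2} + 1, \\ d(n) &= 6 \text{ for } F_{2m+1} + F_{2m-2} + 2 \leq n \leq F_{2m+2}, \\ d(n) &= 8 \text{ for } F_{2m+2} + 1 \leq n \leq F_{2m+2} + F_{2m-1}, \\ d(n) &= 6 \text{ for } F_{2m+2} + F_{2m-1} + 1 \leq n \leq F_{2m+3} + 1. \end{align*}
   Context: The Fibonacci numbers are defined by $F_0 = 0$, $F_1 = 1$, $F_n = F_{n-1} + F_{n-2}$. Every natural number $n$ has a unique Fibonacci (Zeckendorf) representation: a binary word $w = w[1]\cdots w[t]$ with $w[1] = 1$ (if $t \ge 1$; the representation of $0$ is the empty word), with no two consecutive $1$'s, and with $n = \sum_{i=1}^{t} w[i] F_{t+2-i}$. The Fibonacci-Thue-Morse sequence $(\mathbf{ftm}[n])_{n \ge 0}$ is defined by letting $\mathbf{ftm}[n]$ be the sum, modulo $2$, of the bits of the Fibonacci representation of $n$ (so it begins $0,1,1,1,0,1,0,0,1,0,0,0,1,1,0,0,0,1,0,1,\ldots$). Equivalently, $d(n)$ is the number of length-$n$ factors $x$ of $\mathbf{ftm}$ such that both $x0$ and $x1$ are factors of $\mathbf{ftm}$. *)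

theory Defs
  imports "HOL-Number_Theory.Fib"
begin

text \<open>
  A word \<open>w[1] \<cdots> w[t]\<close> is a list, indexed from 0, so that the letter \<open>w ! i\<close> is \<open>w[i+1]\<close> and
  has weight \<open>F\<^bsub>t+2-(i+1)\<^esub>\<close>.
\<close>

definition fib_value :: "nat list \<Rightarrow> nat" where
  "fib_value w = (\<Sum>i<length w. w ! i * fib (length w + 1 - i))"

definition is_fib_rep :: "nat \<Rightarrow> nat list \<Rightarrow> bool" where
  "is_fib_rep n w \<longleftrightarrow>
     set w \<subseteq> {0, 1} \<and>
     (w \<noteq> [] \<longrightarrow> hd w = 1) \<and>
     (\<forall>i. Suc i < length w \<longrightarrow> \<not> (w ! i = 1 \<and> w ! Suc i = 1)) \<and>
     n = fib_value w"

text \<open>Well defined by the lemma \<open>ex1_fib_rep\<close> below.\<close>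

definition fib_rep :: "nat \<Rightarrow> nat list" where
  "fib_rep n = (THE w. is_fib_rep n w)"

definition ftm :: "nat \<Rightarrow> nat" where
  "ftm n = sum_list (fib_rep n) mod 2"

definition factors :: "(nat \<Rightarrow> 'a) \<Rightarrow> nat \<Rightarrow> 'a list set" where
  "factors s n = {map s [i..<i + n] | i. True}"

definition ftm_rho :: "nat \<Rightarrow> nat" where
  "ftm_rho n = card (factors ftm n)"

definition ftm_d :: "nat \<Rightarrow> int" where
  "ftm_d n = int (ftm_rho (n + 1)) - int (ftm_rho n)"


subsection \<open>Existence and uniqueness of the Fibonacci representation\<close>

definition fib_word :: "nat list \<Rightarrow> bool" where
  "fib_word w \<longleftrightarrow>
     set w \<subseteq> {0, 1} \<and> (\<forall>i. Suc i < length w \<longrightarrow> \<not> (w ! i = 1 \<and> w ! Suc i = 1))"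

lemma is_fib_rep_iff:
  "is_fib_rep n w \<longleftrightarrow> fib_word w \<and> (w \<noteq> [] \<longrightarrow> hd w = 1) \<and> fib_value w = n"
  by (auto simp: is_fib_rep_def fib_word_def)

lemma fib_value_Nil [simp]: "fib_value [] = 0"
  by (simp add: fib_value_def)

lemma fib_value_Cons [simp]: "fib_value (b # w) = b * fib (length w + 2) + fib_value w"
  by (simp add: fib_value_def sum.lessThan_Suc_shift del: sum.lessThan_Suc fib.simps)

lemma fib_word_Nil [simp]: "fib_word []"
  by (simp add: fib_word_def)

lemma fib_word_Cons:
  "fib_word (b # w) \<longleftrightarrow> b \<in> {0, 1} \<and> fib_word w \<and> \<not> (b = 1 \<and> w \<noteq> [] \<and> hd w = 1)"
proof -
  have "(\<forall>i. Suc i < length (b # w) \<longrightarrow> \<not> ((b # w) ! i = 1 \<and> (b # w) ! Suc i = 1)) \<longleftrightarrow>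
        (\<forall>i. Suc i < length w \<longrightarrow> \<not> (w ! i = 1 \<and> w ! Suc i = 1)) \<and>
        \<not> (b = 1 \<and> w \<noteq> [] \<and> hd w = 1)"
    (is "(\<forall>i. ?P i) \<longleftrightarrow> _")
  proof -
    have "(\<forall>i. ?P i) \<longleftrightarrow> ?P 0 \<and> (\<forall>i. ?P (Suc i))"
      by (metis not0_implies_Suc)
    then show ?thesis
      by (auto simp: hd_conv_nth)
  qed
  then show ?thesis
    by (auto simp: fib_word_def)
qed


lemma fib_value_less: "fib_word w \<Longrightarrow> fib_value w < fib (length w + 2)"
proof (induction "length w" arbitrary: w rule: less_induct)
  case less
  show ?case
  proof (cases w)
    case Nil
    then show ?thesis by simp
  next
    case (Cons b v)
    have v: "fib_value v < fib (length v + 2)"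
      using less Cons by (auto simp: fib_word_Cons)
    show ?thesis
    proof (cases "b = 0")
      case True
      then show ?thesis using v Cons by simp
    next
      case False
      then have b: "b = 1" using less.prems Cons by (auto simp: fib_word_Cons)
      show ?thesis
      proof (cases v)
        case Nil
        then show ?thesis using Cons b by (simp add: numeral_eq_Suc)
      next
        case (Cons c u)
        then have "c = 0" "fib_word u"
          using less.prems b \<open>w = b # v\<close> by (auto simp: fib_word_Cons)
        moreover have "fib_value u < fib (length u + 2)"
          using less.hyps[of u] \<open>fib_word u\<close> Cons \<open>w = b # v\<close> by simp
        ultimately show ?thesis using Cons \<open>w = b # v\<close> b by simp
      qed
    qed
  qed
qed

lemma fib_word_unique:
  "\<lbrakk>fib_word v; fib_word w; length v = length w; fib_value v = fib_value w\<rbrakk> \<Longrightarrow> v = w"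
proof (induction v arbitrary: w)
  case Nil
  then show ?case by simp
next
  case (Cons b v)
  then obtain c u where w: "w = c # u" by (cases w) auto
  have *: "fib_value v < fib (length v + 2)" "fib_value u < fib (length v + 2)"
    using Cons.prems w fib_value_less[of v] fib_value_less[of u] by (auto simp: fib_word_Cons)
  have "b = c"
    using Cons.prems w * by (auto simp: fib_word_Cons)
  then show ?case
    using Cons w by (auto simp: fib_word_Cons)
qed

lemma fib_word_exists: "n < fib (t + 2) \<Longrightarrow> \<exists>w. fib_word w \<and> length w = t \<and> fib_value w = n"
proof (induction t arbitrary: n rule: less_induct)
  case (less t)
  show ?case
  proof (cases t)
    case 0
    then show ?thesis using less.prems by auto
  next
    case (Suc s)
    show ?thesis
    proof (cases "n < fib (s + 2)")
      case True
      with less.IH[of s n] Suc obtain w where "fib_word w" "length w = s" "fib_value w = n"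
        by auto
      then show ?thesis using Suc by (intro exI[of _ "0 # w"]) (auto simp: fib_word_Cons)
    next
      case False
      show ?thesis
      proof (cases s)
        case 0
        then have "n = 1" using False less.prems Suc by (auto simp: numeral_eq_Suc)
        then show ?thesis using Suc 0 by (intro exI[of _ "[1]"]) (auto simp: fib_word_Cons)
      next
        case (Suc r)
        have "n - fib (s + 2) < fib (r + 2)"
          using False less.prems Suc \<open>t = Suc s\<close> by simp
        with less.IH[of r] Suc \<open>t = Suc s\<close> obtain w where
          "fib_word w" "length w = r" "fib_value w = n - fib (s + 2)"
          by (metis lessI less_SucI)
        then show ?thesis using Suc \<open>t = Suc s\<close> False
          by (intro exI[of _ "1 # 0 # w"]) (auto simp: fib_word_Cons)
      qed
    qed
  qed
qed

lemma fib_word_canonical: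
  "fib_word w \<Longrightarrow> \<exists>v. fib_word v \<and> (v \<noteq> [] \<longrightarrow> hd v = 1) \<and> fib_value v = fib_value w"
proof (induction w)
  case Nil
  show ?case by (intro exI[of _ "[]"]) simp
next
  case (Cons b w)
  show ?case
  proof (cases "b = 0")
    case True
    then show ?thesis using Cons by (auto simp: fib_word_Cons)
  next
    case False
    then show ?thesis using Cons.prems
      by (intro exI[of _ "b # w"]) (auto simp: fib_word_Cons)
  qed
qed

lemma less_fib_add_2: "n < fib (n + 2)"
proof (induction n)
  case (Suc n)
  have "fib (n + 1) > 0" by (rule fib_neq_0_nat) simp
  then show ?case using Suc by simp
qed simp

lemma is_fib_rep_length_le:
  assumes "is_fib_rep n v" "is_fib_rep n w"
  shows "length v \<le> length w"
proof (cases v)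
  case (Cons b u)
  then have "fib (length v + 1) \<le> n"
    using assms(1) by (auto simp: is_fib_rep_iff)
  also have "n < fib (length w + 2)"
    using assms(2) fib_value_less by (auto simp: is_fib_rep_iff)
  finally have "fib (length v + 1) < fib (length w + 2)" .
  then have "\<not> length w + 2 \<le> length v + 1"
    using fib_mono[of "length w + 2" "length v + 1"] by linarith
  then show ?thesis by simp
qed simp

lemma ex1_fib_rep: "\<exists>!w. is_fib_rep n w"
proof (rule ex_ex1I)
  obtain w where "fib_word w" "fib_value w = n"
    using fib_word_exists[OF less_fib_add_2] by blast
  then show "\<exists>w. is_fib_rep n w"
    using fib_word_canonical[of w] by (auto simp: is_fib_rep_iff)
next
  fix v w
  assume "is_fib_rep n v" "is_fib_rep n w"
  then show "v = w"
    using is_fib_rep_length_le[of n v w] is_fib_rep_length_le[of n w v]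
    by (auto simp: is_fib_rep_iff intro: fib_word_unique)
qed

lemma is_fib_rep_fib_rep: "is_fib_rep n (fib_rep n)"
  unfolding fib_rep_def by (rule theI'[OF ex1_fib_rep])

end

theory Submission
  imports Defs "HOL-Library.Sublist"
begin

text \<open>
  Let \<open>\<delta>(n)\<close> record whether \<open>ftm\<close> changes between \<open>n\<close> and \<open>n + 1\<close>. The factors of \<open>ftm\<close> are closed
  under complement, so \<open>ftm\<close> has twice as many factors of length \<open>n + 1\<close> as \<open>\<delta>\<close> has of length \<open>n\<close>.
  The prefixes \<open>P\<^sub>k\<close> of \<open>\<delta>\<close> of length \<open>F\<^sub>k - 1\<close> satisfy \<open>P\<^sub>k\<^sub>+\<^sub>2 = P\<^sub>k\<^sub>+\<^sub>1 g\<^sub>k\<^sub>+\<^sub>1 P\<^sub>k\<close> with single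
  letters \<open>g\<^sub>k\<close> such that \<open>g\<^sub>k\<^sub>+\<^sub>2\<close> is the complement of \<open>g\<^sub>k\<close>.

  From below, \<open>\<rho>\<^sub>\<delta>(n + 1) - \<rho>\<^sub>\<delta>(n)\<close> is at least the number of right special words of length \<open>n\<close>
  that one can exhibit: the suffixes of \<open>P\<^sub>k\<close> for large even and for large odd \<open>k\<close>, and those of
  \<open>P\<^sub>k g\<^sub>k P\<^sub>k\<close> (with one more letter in front if \<open>k\<close> is even) as soon as they split off from these two.
  From above, every factor of length \<open>F\<^sub>k\<close> is a window of \<open>P\<^sub>k x P\<^sub>k\<close> or \<open>P\<^sub>k\<^sub>+\<^sub>1 x P\<^sub>k\<close>, and
  discarding coinciding windows leaves at most \<open>3 F\<^sub>k + F\<^sub>k\<^sub>-\<^sub>2 - 2\<close> words. The lower bounds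
  on the increments add up to exactly this number, so all of them are equalities; in particular no
  recognizability argument is needed to rule out further right special words.
\<close>

section \<open>Fibonacci shifts and the change sequence of \<open>ftm\<close>\<close>

text \<open>Leading zeros alter neither value nor digit sum, so \<open>ftm\<close> can also be read
  off padded words.\<close>

lemma ftm_fib_value:
  assumes "fib_word w"
  shows "ftm (fib_value w) = sum_list w mod 2"
  using assms
proof (induction w)
  case Nil
  have "is_fib_rep 0 []" by (simp add: is_fib_rep_iff)
  then have "fib_rep 0 = []" using ex1_fib_rep is_fib_rep_fib_rep by blast
  then show ?case by (simp add: ftm_def)
next
  case (Cons b w)
  show ?case
  proof (cases "b = 0")
    case True
    then show ?thesis using Cons by (simp add: fib_word_Cons)
  next
    case False
    then have "is_fib_rep (fib_value (b # w)) (b # w)"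
      using Cons.prems by (auto simp: is_fib_rep_iff fib_word_Cons)
    then have "fib_rep (fib_value (b # w)) = b # w"
      using ex1_fib_rep is_fib_rep_fib_rep by blast
    then show ?thesis by (simp add: ftm_def)
  qed
qed

lemma ftm_0: "ftm 0 = 0"
  using ftm_fib_value[of "[]"] by simp

lemma ftm_less_2: "ftm n < 2"
  by (simp add: ftm_def)

lemma ftm_1: "ftm 1 = 1"
  using ftm_fib_value[of "[1]"] by (simp add: fib_word_Cons numeral_2_eq_2)

declare fib.simps(3) [simp del]

text \<open>For positive \<open>k\<close> the bound gives \<open>n\<close> a padded word of
  \<open>k - 1\<close> digits; putting \<open>1 0\<close> in front keeps it free of adjacent ones
  and adds one digit 1.\<close>

lemma ftm_fib_add:
  assumes "n < fib (Suc k)"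
  shows "ftm (fib (Suc (Suc k)) + n) = 1 - ftm n"
proof (cases k)
  case 0
  then show ?thesis using assms ftm_1 ftm_0 by (simp add: numeral_2_eq_2 fib.simps(3))
next
  case (Suc j)
  then obtain w where w: "fib_word w" "length w = j" "fib_value w = n"
    using assms fib_word_exists[of n j] by auto
  have "fib_word (1 # 0 # w)" "fib_value (1 # 0 # w) = fib (Suc (Suc k)) + n"
    using w Suc by (auto simp: fib_word_Cons)
  then have "ftm (fib (Suc (Suc k)) + n) = Suc (sum_list w) mod 2"
    using ftm_fib_value[of "1 # 0 # w"] by simp
  moreover have "ftm n = sum_list w mod 2"
    using ftm_fib_value[of w] w by simp
  ultimately show ?thesis by (simp add: mod2_eq_if)
qed

definition dftm :: "nat \<Rightarrow> bool" where
  "dftm n \<longleftrightarrow> ftm n \<noteq> ftm (Suc n)"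

lemma dftm_fib_add:
  assumes "Suc n < fib (Suc k)"
  shows "dftm (fib (Suc (Suc k)) + n) = dftm n"
proof -
  have "ftm (fib (Suc (Suc k)) + n) = 1 - ftm n" "ftm (Suc (fib (Suc (Suc k)) + n)) = 1 - ftm (Suc n)"
    using ftm_fib_add[of n k] ftm_fib_add[of "Suc n" k] assms by auto
  then show ?thesis
    using ftm_less_2[of n] ftm_less_2[of "Suc n"] unfolding dftm_def by linarith
qed

text \<open>Inverse of taking changes: rebuilds a binary word from its first letter and its
  changes.\<close>

fun undiff :: "nat \<Rightarrow> bool list \<Rightarrow> nat list" where
  "undiff c [] = [c]"
| "undiff c (b # v) = c # undiff (if b then 1 - c else c) v"

lemma map_ftm_eq_undiff: "map ftm [i..<i + Suc n] = undiff (ftm i) (map dftm [i..<i + n])"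
proof (induction n arbitrary: i)
  case (Suc n)
  have "ftm (Suc i) = (if dftm i then 1 - ftm i else ftm i)"
    using ftm_less_2[of i] ftm_less_2[of "Suc i"] by (auto simp: dftm_def)
  then show ?case using Suc[of "Suc i"] by (simp add: upt_conv_Cons del: upt_Suc)
qed simp

lemma undiff_inject:
  assumes "undiff c v = undiff d w" "c < 2" "d < 2"
  shows "c = d \<and> v = w"
  using assms
proof (induction v arbitrary: c d w)
  case Nil
  then show ?case by (cases w; cases "tl w") auto
next
  case (Cons b v)
  then obtain b' w' where w: "w = b' # w'" by (cases w; cases v) auto
  have "c = d" using Cons.prems w by simp
  moreover have "(if b then 1 - c else c) = (if b' then 1 - d else d) \<and> v = w'"
    by (rule Cons.IH) (use Cons.prems w in auto)
  ultimately show ?case using w Cons.prems by (cases b; cases b') (simp_all, arith+)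
qed

lemma finite_factors:
  fixes s :: "nat \<Rightarrow> bool"
  shows "finite (factors s n)"
proof -
  have "factors s n \<subseteq> {xs. set xs \<subseteq> UNIV \<and> length xs = n}"
    by (auto simp: factors_def)
  then show ?thesis by (rule finite_subset) (rule finite_lists_length_eq, simp)
qed

text \<open>
  Adding a large Fibonacci number to all positions complements the factor of
  \<open>ftm\<close> and preserves that of \<open>dftm\<close>.
\<close>

lemma ftm_rho_Suc: "ftm_rho (Suc n) = 2 * card (factors dftm n)"
proof -
  have "factors ftm (Suc n) = (\<lambda>(c, v). undiff c v) ` ({0, 1} \<times> factors dftm n)" (is "?L = ?R")
  proof (intro equalityI subsetI)
    fix w assume "w \<in> ?L"
    then obtain i where "w = undiff (ftm i) (map dftm [i..<i + n])"
      unfolding factors_def using map_ftm_eq_undiff by auto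
    moreover have "ftm i \<in> {0, 1}" using ftm_less_2[of i] by auto
    ultimately show "w \<in> ?R" by (force simp: factors_def)
  next
    fix w assume "w \<in> ?R"
    then obtain c i where c: "c \<in> {0, 1}" and w: "w = undiff c (map dftm [i..<i + n])"
      by (auto simp: factors_def)
    show "w \<in> ?L"
    proof (cases "c = ftm i")
      case True
      then show ?thesis using w map_ftm_eq_undiff by (auto simp: factors_def)
    next
      case False
      define k where "k = Suc (i + n)"
      have k: "i + n < fib (Suc k)"
        using less_fib_add_2[of "i + n"] by (simp add: k_def)
      let ?f = "fib (Suc (Suc k))"
      have "c = 1 - ftm i" using c False ftm_less_2[of i] by auto
      then have c: "c = ftm (?f + i)" using ftm_fib_add[of i k] k by simp
      have "dftm (?f + (i + j)) = dftm (i + j)" if "j < n" for j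
        using k that by (intro dftm_fib_add) simp
      then have "map dftm [i..<i + n] = map dftm [?f + i..<?f + i + n]"
        by (intro nth_equalityI) (auto simp: add.assoc)
      then have "w = map ftm [?f + i..<?f + i + Suc n]"
        using w c map_ftm_eq_undiff[of "?f + i" n] by simp
      then show ?thesis by (auto simp: factors_def)
    qed
  qed
  moreover have "inj_on (\<lambda>(c, v). undiff c v) ({0, 1} \<times> factors dftm n)"
  proof (rule inj_onI, clarify)
    fix c v d w
    assume "undiff c v = undiff d w" "c \<in> {0, 1}" "d \<in> {0, 1}"
    then show "c = d \<and> v = w" by (intro undiff_inject) auto
  qed
  ultimately show ?thesis
    by (simp add: ftm_rho_def card_image card_cartesian_product)
qed

lemma ftm_d_Suc:
  "ftm_d (Suc n) = 2 * (int (card (factors dftm (Suc n))) - int (card (factors dftm n)))"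
  by (simp add: ftm_d_def ftm_rho_Suc)

section \<open>Prefixes of Fibonacci length and their separating letters\<close>

text \<open>The change between \<open>fib k - 1\<close> and \<open>fib k\<close>, which is where
  \<open>dftm_fib_add\<close> stops applying.\<close>

definition gap :: "nat \<Rightarrow> bool" where
  "gap k = dftm (fib k - 1)"

definition pref :: "nat \<Rightarrow> bool list" where
  "pref k = map dftm [0..<fib k - 1]"

lemma length_pref [simp]: "length (pref k) = fib k - 1"
  by (simp add: pref_def)

lemma fib_Suc_pos [simp]: "0 < fib (Suc k)"
  by (rule fib_neq_0_nat) simp

lemma ftm_fib: "ftm (fib (Suc k)) = 1"
  using ftm_fib_add[of 0 "k - 1"] ftm_0 ftm_1 by (cases k) auto

text \<open>\<open>ftm\<close> is 1 at positive Fibonacci numbers, while the shift flips the letter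
  just before them.\<close>

lemma gap_add_2: "gap (Suc (Suc (Suc k))) = (\<not> gap (Suc k))"
proof -
  have "fib (Suc (Suc (Suc k))) - 1 = fib (Suc (Suc k)) + (fib (Suc k) - 1)"
    using fib_Suc_pos[of k] unfolding fib.simps(3)[of "Suc k"] by linarith
  then have "ftm (fib (Suc (Suc (Suc k))) - 1) = 1 - ftm (fib (Suc k) - 1)"
    using ftm_fib_add[of "fib (Suc k) - 1" k] by simp
  then show ?thesis
    using ftm_less_2[of "fib (Suc k) - 1"] ftm_fib[of k] ftm_fib[of "Suc (Suc k)"]
    unfolding gap_def dftm_def by simp linarith
qed

lemma pref_add_2: "pref (Suc (Suc (Suc k))) = pref (Suc (Suc k)) @ gap (Suc (Suc k)) # pref (Suc k)"
proof -
  let ?x = "fib (Suc (Suc k))" and ?y = "fib (Suc k)"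
  have pos: "0 < ?x" "0 < ?y" by simp_all
  have "dftm (?x + i) = dftm i" if "i < ?y - 1" for i
    using that by (intro dftm_fib_add) simp
  then have "map dftm [?x..<?x + (?y - 1)] = map dftm [0..<?y - 1]"
    by (intro nth_equalityI) auto
  moreover have "[0..<fib (Suc (Suc (Suc k))) - 1] = [0..<?x - 1] @ (?x - 1) # [?x..<?x + (?y - 1)]"
  proof -
    obtain x' y' where xy: "?x = Suc x'" "?y = Suc y'" using pos not0_implies_Suc by blast
    then have "fib (Suc (Suc (Suc k))) - 1 = x' + Suc y'" by (simp add: fib.simps(3)[of "Suc k"])
    moreover have "[0..<x' + Suc y'] = [0..<x'] @ x' # [Suc x'..<Suc x' + y']"
      unfolding upt_add_eq_append[OF le0] by (simp add: upt_conv_Cons del: upt_Suc)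
    ultimately show ?thesis by (simp add: xy del: upt_Suc)
  qed
  ultimately show ?thesis
    unfolding pref_def gap_def by simp
qed

lemma gap_rec: "1 \<le> k \<Longrightarrow> gap (k + 2) = (\<not> gap k)"
  using gap_add_2[of "k - 1"] by simp

lemma pref_rec: "1 \<le> k \<Longrightarrow> pref (k + 2) = pref (k + 1) @ gap (k + 1) # pref k"
  using pref_add_2[of "k - 1"] by simp

lemma pref_rec': "3 \<le> k \<Longrightarrow> pref k = pref (k - 1) @ gap (k - 1) # pref (k - 2)"
  using pref_add_2[of "k - 3"] by (simp add: numeral_eq_Suc Suc_diff_Suc)

lemma gap_2: "gap 2"
  using ftm_0 ftm_1 by (simp add: gap_def dftm_def numeral_2_eq_2 fib.simps(3))

lemma gap_3: "\<not> gap 3"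
  using ftm_1 ftm_fib[of 2] by (simp add: gap_def dftm_def numeral_eq_Suc fib.simps(3))

text \<open>Raising \<open>k\<close> by two flips both gaps, so computing \<open>k = 2\<close> and
  \<open>k = 3\<close> suffices. The later parity distinctions come from here and from
  \<open>pref_last\<close>.\<close>

lemma gap_Suc: "2 \<le> k \<Longrightarrow> gap (k + 1) = (gap k = odd k)"
proof (induction k rule: less_induct)
  case (less k)
  show ?case
  proof (cases "k < 4")
    case True
    with less.prems have "k = 2 \<or> k = 3" by auto
    then show ?thesis using gap_2 gap_3 gap_rec[of 2] by auto
  next
    case False
    then have "gap (k - 2 + 1) = (gap (k - 2) = odd k)" using less.IH[of "k - 2"] by simp
    moreover have "k - 2 + 1 + 2 = k + 1" "k - 2 + 2 = k" using False by auto
    ultimately show ?thesis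
      using gap_rec[of "k - 2"] gap_rec[of "k - 2 + 1"] False by auto
  qed
qed

text \<open>The last letter is inherited from \<open>pref (k - 2)\<close>. It separates the suffixes
  of consecutive prefixes.\<close>

lemma pref_last: "3 \<le> k \<Longrightarrow> \<exists>u. pref k = u @ [odd k]"
proof (induction k rule: less_induct)
  case (less k)
  have e: "pref 1 = []" "pref 2 = []" by (simp_all add: pref_def numeral_2_eq_2 fib.simps(3))
  show ?case
  proof (cases "k < 5")
    case True
    with less.prems have "k = 3 \<or> k = 4" by auto
    moreover have "pref 3 = [True]" using pref_rec[of 1] e gap_2 by (simp add: numeral_eq_Suc)
    moreover from this have "pref 4 = [True, False]" using pref_rec[of 2] e gap_3 by (simp add: numeral_eq_Suc)
    ultimately show ?thesis by auto
  next
    case False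
    then have "3 \<le> k - 2" "k - 2 < k" "odd (k - 2) = odd k" by auto
    moreover from this obtain u where "pref (k - 2) = u @ [odd (k - 2)]" using less.IH by blast
    ultimately have "pref k = (pref (k - 1) @ gap (k - 1) # u) @ [odd k]"
      using pref_rec'[of k] False by simp
    then show ?thesis by blast
  qed
qed

lemma prefix_pref: "j \<le> k \<Longrightarrow> prefix (pref j) (pref k)"
proof -
  assume "j \<le> k"
  then have "fib j - 1 \<le> fib k - 1" using fib_mono by (simp add: diff_le_mono)
  then obtain d where d: "fib k - 1 = fib j - 1 + d" using le_Suc_ex by blast
  show ?thesis unfolding pref_def d upt_add_eq_append[OF le0] by simp
qed

section \<open>Factors of \<open>dftm\<close> and right special words\<close>

text \<open>The factors of \<open>dftm\<close> without positions, so that membership follows from a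
  decomposition of some \<open>pref k\<close>.\<close>

definition lang :: "bool list set" where
  "lang = {w. \<exists>k. sublist w (pref k)}"

lemma lang_closed: "\<lbrakk>w \<in> lang; sublist v w\<rbrakk> \<Longrightarrow> v \<in> lang"
  unfolding lang_def using sublist_order.order_trans by blast

lemma langI: "pref k = u @ w @ v \<Longrightarrow> w \<in> lang"
  unfolding lang_def sublist_def by blast

lemma factors_dftm: "factors dftm n = {w \<in> lang. length w = n}"
proof (intro equalityI subsetI)
  fix w assume "w \<in> factors dftm n"
  then obtain i where w: "w = map dftm [i..<i + n]" by (auto simp: factors_def)
  obtain d where d: "fib (i + n + 2) - 1 = (i + n) + d"
    using less_fib_add_2[of "i + n"] by (metis Suc_leI Suc_pred' add.commute add_leE diff_le_mono
        diff_Suc_1 le_Suc_ex)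
  have "pref (i + n + 2) = map dftm [0..<i] @ w @ map dftm [i + n..<i + n + d]"
    unfolding pref_def d w upt_add_eq_append[OF le0] by simp
  then show "w \<in> {w \<in> lang. length w = n}" using langI w by auto
next
  fix w assume "w \<in> {w \<in> lang. length w = n}"
  then obtain k u v where p: "pref k = u @ w @ v" and n: "length w = n"
    by (auto simp: lang_def sublist_def)
  have len: "length u + n \<le> fib k - 1"
    using n arg_cong[OF p, of length] by simp
  have "w ! j = dftm (length u + j)" if "j < n" for j
  proof -
    have "w ! j = pref k ! (length u + j)" using p that n by (simp add: nth_append)
    then show ?thesis using len that by (simp add: pref_def)
  qed
  then have "w = map dftm [length u..<length u + n]"
    using n by (intro nth_equalityI) auto
  then show "w \<in> factors dftm n" by (auto simp: factors_def)
qed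

definition rspecial :: "nat \<Rightarrow> bool list set" where
  "rspecial n = {w. length w = n \<and> (\<forall>x. w @ [x] \<in> lang)}"

lemma finite_rspecial: "finite (rspecial n)"
proof -
  have "rspecial n \<subseteq> factors dftm n"
    unfolding rspecial_def factors_dftm by (auto intro: lang_closed)
  then show ?thesis using finite_factors finite_subset by blast
qed

text \<open>Each factor has a right extension \<open>e w\<close>; a right special one also admits
  \<open>\<not> e w\<close>.\<close>

lemma card_factors_Suc_ge:
  "card (factors dftm n) + card (rspecial n) \<le> card (factors dftm (Suc n))"
proof -
  have "\<forall>w\<in>factors dftm n. \<exists>x. w @ [x] \<in> factors dftm (Suc n)"
  proof
    fix w assume "w \<in> factors dftm n"
    then obtain i where "w = map dftm [i..<i + n]" by (auto simp: factors_def)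
    then have "w @ [dftm (i + n)] = map dftm [i..<i + Suc n]" by simp
    then show "\<exists>x. w @ [x] \<in> factors dftm (Suc n)" unfolding factors_def by blast
  qed
  then obtain e where e: "\<And>w. w \<in> factors dftm n \<Longrightarrow> w @ [e w] \<in> factors dftm (Suc n)"
    by metis
  let ?A = "(\<lambda>w. w @ [e w]) ` factors dftm n" and ?B = "(\<lambda>w. w @ [\<not> e w]) ` rspecial n"
  have "?A \<union> ?B \<subseteq> factors dftm (Suc n)"
    using e by (auto simp: rspecial_def factors_dftm)
  then have "card (?A \<union> ?B) \<le> card (factors dftm (Suc n))"
    using finite_factors card_mono by blast
  moreover have "?A \<inter> ?B = {}" by auto
  moreover have "card ?A = card (factors dftm n)" "card ?B = card (rspecial n)"
    by (auto intro!: card_image inj_onI)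
  ultimately show ?thesis using finite_rspecial finite_factors by (simp add: card_Un_disjoint)
qed

definition suf :: "nat \<Rightarrow> 'a list \<Rightarrow> 'a list" where
  "suf n w = drop (length w - n) w"

lemma length_suf [simp]: "length (suf n w) = min n (length w)"
  by (auto simp: suf_def)

lemma suffix_eq_suf: "suffix v w \<Longrightarrow> v = suf (length v) w"
  by (auto simp: suffix_def suf_def)

lemma suf_neq:
  assumes "x \<noteq> y" "length t < n"
  shows "suf n (u @ x # t) \<noteq> suf n (u' @ y # t)"
proof
  assume "suf n (u @ x # t) = suf n (u' @ y # t)"
  moreover have "suf n (v @ z # t) = drop (length v + Suc (length t) - n) v @ z # t" for v z
    using assms(2) by (simp add: suf_def)
  ultimately show False using assms(1) by simp
qed

lemma suf_rspecial:
  assumes "\<And>x. w @ [x] \<in> lang" "n \<le> length w"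
  shows "suf n w \<in> rspecial n"
proof -
  have "sublist (suf n w @ [x]) (w @ [x])" for x
    by (rule suffix_imp_sublist) (simp add: suf_def suffix_drop)
  then show ?thesis using assms lang_closed by (auto simp: rspecial_def)
qed

section \<open>Exhibiting right special words\<close>

lemma pref_expand:
  assumes "1 \<le> k"
  defines "Z \<equiv> pref k" and "X \<equiv> pref (k + 1)" and "a \<equiv> gap (k + 1)" and "b \<equiv> gap (k + 2)"
  shows "pref (k + 2) = X @ a # Z"
    and "pref (k + 3) = X @ a # Z @ b # X"
    and "pref (k + 4) = X @ a # Z @ b # X @ (\<not> a) # X @ a # Z"
    and "pref (k + 5) = X @ a # Z @ b # X @ (\<not> a) # X @ a # Z @ (\<not> b) # X @ a # Z @ b # X"
    and "pref (k + 6) = pref (k + 5) @ a # pref (k + 4)"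
proof -
  have g: "gap (k + 3) = (\<not> a)" "gap (k + 4) = (\<not> b)" "gap (k + 5) = a"
    using gap_rec[of "k + 1"] gap_rec[of "k + 2"] gap_rec[of "k + 3"]
    by (simp_all add: a_def b_def numeral_eq_Suc)
  show 2: "pref (k + 2) = X @ a # Z"
    using pref_rec[of k] assms by simp
  show 3: "pref (k + 3) = X @ a # Z @ b # X"
    using pref_rec[of "k + 1"] 2 by (simp add: X_def a_def b_def numeral_eq_Suc)
  show 4: "pref (k + 4) = X @ a # Z @ b # X @ (\<not> a) # X @ a # Z"
    using pref_rec[of "k + 2"] 2 3 g by (simp add: numeral_eq_Suc)
  show "pref (k + 5) = X @ a # Z @ b # X @ (\<not> a) # X @ a # Z @ (\<not> b) # X @ a # Z @ b # X"
    using pref_rec[of "k + 3"] 3 4 g by (simp add: numeral_eq_Suc)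
  show "pref (k + 6) = pref (k + 5) @ a # pref (k + 4)"
    using pref_rec[of "k + 4"] g by (simp add: numeral_eq_Suc)
qed

text \<open>\<open>gap k\<close> follows the first \<open>pref k\<close> in a longer prefix; its
  negation follows a later occurrence in \<open>pref (k + 3)\<close>.\<close>

lemma pref_ext:
  assumes "2 \<le> k"
  shows "pref k @ [x] \<in> lang"
proof -
  define j where "j = k - 1"
  have j: "1 \<le> j" "k = j + 1" using assms by (auto simp: j_def)
  note e = pref_expand[OF j(1)]
  show ?thesis
  proof (cases "x = gap k")
    case True
    then show ?thesis using e(1) j by (intro langI[of "j + 2" "[]" _ "pref j"]) simp
  next
    case False
    then show ?thesis using e(3) j
      by (intro langI[of "j + 4" "pref k @ gap k # pref j @ [gap (j + 2)]" _ "pref k @ gap k # pref j"])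
        auto
  qed
qed

text \<open>One extension is found with \<open>gap (k + 1)\<close> on its left, the other with
  \<open>\<not> gap k\<close>. For even \<open>k\<close> these letters agree, which gains one more
  letter in front.\<close>

lemma branch_ext:
  assumes "4 \<le> k"
  defines "X \<equiv> pref k" and "a \<equiv> gap k"
  shows "X @ a # X @ [x] \<in> lang"
    and "even k \<Longrightarrow> (\<not> a) # X @ a # X @ [x] \<in> lang"
proof -
  define j where "j = k - 1"
  have j: "1 \<le> j" "3 \<le> j" "k = j + 1" using assms by (auto simp: j_def)
  define Z b where "Z = pref j" and "b = gap (j + 2)"
  note e = pref_expand[OF j(1), folded Z_def b_def, folded j(3), folded X_def a_def]
  have g: "gap j = (\<not> b)" "gap (j - 1) = (\<not> a)"
    using gap_rec[of j] gap_rec[of "j - 1"] j by (simp_all add: a_def b_def)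
  \<comment> \<open>This occurrence straddles the \<open>a\<close> that joins
    \<open>pref (j + 5)\<close> to \<open>pref (j + 4)\<close>.\<close>
  have 1: "b # X @ a # X @ [a] \<in> lang"
    using e(3-5) by (intro langI[of "j + 6" "X @ a # Z @ b # X @ (\<not> a) # X @ a # Z @ (\<not> b) # X @ a # Z"
          _ "Z @ b # X @ (\<not> a) # X @ a # Z"]) simp
  have "X = pref j @ gap j # pref (j - 1)" "pref j = pref (j - 1) @ gap (j - 1) # pref (j - 2)"
    using pref_rec[of "j - 1"] pref_rec[of "j - 2"] j by (simp_all add: X_def numeral_eq_Suc Suc_diff_Suc)
  then obtain v where X: "X = Z @ (\<not> b) # pref (j - 1)" "X = pref (j - 1) @ (\<not> a) # v"
    using g by (auto simp: Z_def)
  \<comment> \<open>Inside \<open>X a Z (\<not> b) X\<close> the letters after the first \<open>a\<close> spell \<open>X\<close> again, followed by \<open>\<not> a\<close>.\<close>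
  have "pref (j + 5) = X @ a # Z @ b # X @ (\<not> a) # X @ a # (Z @ (\<not> b) # pref (j - 1)) @ (\<not> a) # v @ a # Z @ b # X"
    unfolding e(4) by (subst (4) X(2)) simp
  then have 2: "(\<not> a) # X @ a # X @ [\<not> a] \<in> lang"
    unfolding X(1)[symmetric] by (intro langI[of "j + 5" "X @ a # Z @ b # X" _ "v @ a # Z @ b # X"]) simp
  show "X @ a # X @ [x] \<in> lang"
  proof (cases "x = a")
    case True
    have "X @ a # X @ [a] \<in> lang" by (rule lang_closed[OF 1]) (simp add: sublist_Cons_right)
    then show ?thesis using True by simp
  next
    case False
    have "X @ a # X @ [\<not> a] \<in> lang" by (rule lang_closed[OF 2]) (simp add: sublist_Cons_right)
    then show ?thesis using False by (cases x; cases a) auto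
  qed
  show "(\<not> a) # X @ a # X @ [x] \<in> lang" if "even k"
  proof -
    have "b = (\<not> a)" using gap_Suc[of k] that j by (simp add: a_def b_def)
    then show ?thesis using 1 2 by (cases x; cases a) simp_all
  qed
qed

text \<open>
  The third kind of right special words, besides the suffixes of \<open>pref\<close>; the word is the longest one of
  its kind, so that the suffixes stop being right special beyond its length.
\<close>

definition branch :: "nat \<Rightarrow> bool list" where
  "branch k = (if even k then [\<not> gap k] else []) @ pref k @ gap k # pref k"

lemma branch_append_lang: "4 \<le> k \<Longrightarrow> branch k @ [x] \<in> lang"
  using branch_ext[of k x] by (simp add: branch_def)

lemma length_branch: "1 \<le> k \<Longrightarrow> length (branch k) = (if even k then 2 * fib k else 2 * fib k - 1)"
  using fib_neq_0_nat[of k] by (auto simp: branch_def)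

text \<open>Both words end in \<open>pref k\<close>, preceded by \<open>gap k\<close> and
  \<open>gap (k + 1)\<close> respectively. For even \<open>k\<close> these differ; for odd
  \<open>k\<close> they agree, and the difference lies one letter further left, between the last
  letters of \<open>pref k\<close> and \<open>pref (k - 1)\<close>.\<close>

lemma suf_branch_neq:
  assumes "4 \<le> k" "if even k then fib k \<le> n else fib k < n"
  shows "suf n (branch k) \<noteq> suf n (pref (k + 2))"
proof -
  define j where "j = k - 1"
  have j: "k = j + 1" "3 \<le> j" using assms by (auto simp: j_def)
  have p: "pref (k + 2) = pref k @ gap k # pref j @ gap (k + 1) # pref k"
    using pref_expand(2)[of j] j by (simp add: numeral_eq_Suc)
  have pos: "0 < fib k" using assms by (intro fib_neq_0_nat) simp
  show ?thesis
  proof (cases "even k")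
    case True
    then have "gap k \<noteq> gap (k + 1)" using gap_Suc[of k] assms by simp
    then show ?thesis
      using suf_neq[of "gap k" "gap (k + 1)" "pref k" n "(\<not> gap k) # pref k" "pref k @ gap k # pref j"]
        True assms(2) pos by (simp add: branch_def p[simplified])
  next
    case False
    then have g: "gap (k + 1) = gap k" using gap_Suc[of k] assms by simp
    obtain u v where uv: "pref k = u @ [True]" "pref j = v @ [False]"
      using pref_last[of k] pref_last[of j] False j by auto
    moreover have "Suc (length u) = fib k - 1" using arg_cong[OF uv(1), of length] by simp
    ultimately show ?thesis
      using suf_neq[of True False "gap k # pref k" n u "pref k @ gap k # v"]
        False assms(2) pos by (simp add: branch_def p[simplified] g[simplified])
  qed
qed

lemma suf_last_neq:
  assumes "w = u @ [x]" "w' = u' @ [y]" "x \<noteq> y" "0 < n"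
  shows "suf n w \<noteq> suf n w'"
  using suf_neq[of x y "[]" n u u'] assms by simp

lemma branch_last: "3 \<le> k \<Longrightarrow> \<exists>u. branch k = u @ [odd k]"
  using pref_last[of k] by (auto simp: branch_def)

text \<open>Four candidates: \<open>?E\<close> and \<open>?C\<close> end in \<open>odd j\<close>,
  \<open>?O\<close> and \<open>?B\<close> in \<open>odd k\<close>. Within each pair
  \<open>suf_branch_neq\<close> separates them, except that \<open>?B\<close> is not separated from
  \<open>?O\<close> when \<open>k\<close> is odd and \<open>n = fib k\<close>.\<close>

lemma card_rspecial_ge:
  assumes k: "5 \<le> k" and n: "fib k \<le> n" "n < fib (k + 1)"
  shows "(if even k \<or> fib k < n then 3 else 2) + (if n \<le> length (branch (k - 1)) then 1 else 0)
    \<le> card (rspecial n)"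
proof -
  define j where "j = k - 1"
  have j: "k = j + 1" "4 \<le> j" using k by (auto simp: j_def)
  have pos: "0 < fib k" "0 < fib j" "0 < fib (j - 1)" using k j by (auto intro!: fib_neq_0_nat)
  have fk: "fib k = fib j + fib (j - 1)" "fib (k + 1) = fib k + fib j"
    using fib.simps(3)[of "j - 1"] fib.simps(3)[of j] j by (simp_all add: numeral_eq_Suc)
  have n0: "0 < n" "fib j < n" using n pos fk by auto
  let ?E = "suf n (pref (k + 1))" and ?O = "suf n (pref (k + 2))"
    and ?B = "suf n (branch k)" and ?C = "suf n (branch j)"
  have le: "n \<le> length (pref (k + 1))" "n \<le> length (pref (k + 2))"
    using n fib_mono[of "k + 1" "k + 2"] by auto
  have lb: "n \<le> length (branch k)"
    using n fk pos length_branch[of k] k by auto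
  obtain u v where uv: "pref (k + 1) = u @ [odd j]" "pref (k + 2) = v @ [odd k]"
    using pref_last[of "k + 1"] pref_last[of "k + 2"] k j by auto
  obtain u' v' where uv': "branch j = u' @ [odd j]" "branch k = v' @ [odd k]"
    using branch_last[of j] branch_last[of k] k j by auto
  have ne: "odd j \<noteq> odd k" using j by simp
  have in_rs: "?E \<in> rspecial n" "?O \<in> rspecial n" "?B \<in> rspecial n"
    using le lb k by (auto intro!: suf_rspecial pref_ext branch_append_lang)
  have d: "?E \<noteq> ?O" "?E \<noteq> ?B" "?C \<noteq> ?O" "?C \<noteq> ?B"
    using ne n0 suf_last_neq uv uv' by metis+
  have d1: "?C \<noteq> ?E" using suf_branch_neq[of j n] n0 j by simp
  have d2: "?B \<noteq> ?O" if "even k \<or> fib k < n" using suf_branch_neq[of k n] n k that by (cases "even k") auto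
  define S where "S = {?E, ?O} \<union> (if even k \<or> fib k < n then {?B} else {}) \<union>
    (if n \<le> length (branch j) then {?C} else {})"
  have "S \<subseteq> rspecial n"
    using in_rs suf_rspecial[of "branch j" n] branch_append_lang[of j] j by (auto simp: S_def)
  then have "card S \<le> card (rspecial n)" using finite_rspecial card_mono by blast
  moreover have "card S = (if even k \<or> fib k < n then 3 else 2) + (if n \<le> length (branch j) then 1 else 0)"
    using d d1 d2 by (auto simp: S_def)
  ultimately show ?thesis by (simp add: j_def)
qed

section \<open>Upper bound by counting windows\<close>

lemma sublist_cross:
  assumes "sublist w (t @ x # v)"
  obtains "sublist w t" | "sublist w v" | y z where "w = y @ x # z" "suffix y t" "prefix z v"
  using assms that
  by (auto simp: sublist_append sublist_Cons_right prefix_Cons intro: suffix_imp_sublist)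
    (metis append_Nil suffix_bot.bot_least)

lemma sublist_crossI:
  assumes "w = y @ x # z" "suffix y t" "prefix z v"
  shows "sublist w (t @ x # v)"
proof -
  obtain p q where "t = p @ y" "v = z @ q" using assms by (auto simp: suffix_def prefix_def)
  then have "t @ x # v = p @ w @ q" using assms by simp
  then show ?thesis by (metis sublist_appendI)
qed

text \<open>\<open>pref (m - 2)\<close> is a suffix of \<open>pref m\<close>, and descending by twos
  ends at \<open>k\<close> or \<open>k + 1\<close>.\<close>

lemma suffix_pref:
  assumes "1 \<le> k"
  shows "k \<le> m \<Longrightarrow> suffix (pref k) (pref m) \<or> suffix (pref (k + 1)) (pref m)"
proof (induction m rule: less_induct)
  case (less m)
  show ?case
  proof (cases "m \<le> k + 1")
    case True
    then have "m = k \<or> m = k + 1" using less.prems by auto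
    then show ?thesis by auto
  next
    case False
    then have m: "k \<le> m - 2" "m - 2 < m" "m = m - 2 + 2" by auto
    have "suffix (pref (m - 2)) (pref m)"
      using pref_rec[of "m - 2"] m assms unfolding suffix_def
      by (metis append.assoc append_Cons append_Nil le_trans)
    then show ?thesis using less.IH[OF m(2,1)] suffix_order.order_trans by blast
  qed
qed

text \<open>A factor of \<open>pref m\<close> lies in a shorter prefix or straddles the separating
  letter. In the latter case it sees at most \<open>fib k - 1\<close> letters on each side, too few
  to distinguish more contexts.\<close>

lemma lang_window:
  assumes k: "2 \<le> k" and w: "w \<in> lang" "length w = fib k"
  defines "X \<equiv> pref k"
  shows "\<exists>x. sublist w (X @ x # X) \<or> sublist w (pref (k + 1) @ x # X)"
proof -
  have pos: "0 < fib k" using k by (intro fib_neq_0_nat) simp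
  obtain m where "sublist w (pref m)" using w by (auto simp: lang_def)
  then show ?thesis
  proof (induction m rule: less_induct)
    case (less m)
    have "length w \<le> fib m - 1" using sublist_length_le[OF less.prems] by simp
    then have "\<not> m \<le> k" using fib_mono[of m k] w pos by linarith
    show ?case
    proof (cases "m = k + 1")
      case True
      then show ?thesis using less.prems sublist_order.order_trans by blast
    next
      case False
      then have m: "k \<le> m - 2" "k \<le> m - 1" "m - 1 < m" "m - 2 < m" "m = m - 2 + 2" "m - 2 + 1 = m - 1"
        using \<open>\<not> m \<le> k\<close> by auto
      have "pref m = pref (m - 1) @ gap (m - 1) # pref (m - 2)"
        using pref_rec[of "m - 2"] m k by simp
      with less.prems have "sublist w (pref (m - 1) @ gap (m - 1) # pref (m - 2))" by simp
      then show ?thesis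
      proof (cases rule: sublist_cross)
        case 1
        then show ?thesis using less.IH m by blast
      next
        case 2
        then show ?thesis using less.IH m by blast
      next
        case (3 y z)
        have len: "length y \<le> length X" "length z \<le> length X" using 3 w by (auto simp: X_def)
        have "length X \<le> length (pref (k + 1))"
          using prefix_length_le[OF prefix_pref[of k "k + 1"]] by (simp add: X_def)
        then have "suffix y X \<or> suffix y (pref (k + 1))"
          using suffix_pref[of k "m - 1"] m k 3 len suffix_length_suffix unfolding X_def
          by (meson le_trans one_le_numeral)
        moreover have "prefix z X"
          using prefix_pref[OF m(1)] 3 len prefix_length_prefix unfolding X_def by blast
        ultimately show ?thesis using sublist_crossI[OF 3(1)] by auto
      qed
    qed
  qed
qed

lemma prefix_eq_take: "prefix z v \<Longrightarrow> z = take (length z) v"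
  by (auto simp: prefix_def)

lemma card_factors_fib_le:
  assumes k: "4 \<le> k"
  shows "card (factors dftm (fib k)) + 2 \<le> 3 * fib k + fib (k - 2)"
proof -
  let ?N = "fib k"
  define X where "X = pref k"
  define Z where "Z = pref (k - 1)"
  define a where "a = gap k"
  define b where "b = gap (k + 1)"
  have pos: "0 < ?N" "0 < fib (k - 1)" "0 < fib (k - 2)" using k by (auto intro!: fib_neq_0_nat)
  have fk: "?N = fib (k - 1) + fib (k - 2)"
    using fib.simps(3)[of "k - 2"] k by (simp add: numeral_eq_Suc Suc_diff_Suc)
  have lX: "length X = ?N - 1" and lZ: "length Z = fib (k - 1) - 1" by (simp_all add: X_def Z_def)
  have ks: "k = k - 2 + 2" "k - 2 + 1 = k - 1" "k - 1 = k - 3 + 2" "k - 3 + 1 = k - 2" "k - 1 + 2 = k + 1"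
    "k - 1 + 1 = k" "1 \<le> k - 2" "1 \<le> k - 3" "1 \<le> k - 1"
    using k by auto
  have g: "gap (k - 1) = (\<not> b)" "gap (k - 2) = (\<not> a)"
    using gap_rec[of "k - 1"] gap_rec[of "k - 2"] ks by (auto simp: a_def b_def)
  have T: "pref (k + 1) = X @ a # Z"
    using pref_rec[of "k - 1"] ks by (simp add: X_def Z_def a_def)
  have X: "X = Z @ (\<not> b) # pref (k - 2)"
    using pref_rec[of "k - 2"] ks g by (simp add: X_def Z_def)
  have Z: "Z = pref (k - 2) @ (\<not> a) # pref (k - 3)"
    using pref_rec[of "k - 3"] ks g by (simp add: Z_def)
  have ZX: "prefix Z X" unfolding Z_def X_def by (rule prefix_pref) simp
  \<comment> \<open>The window of length \<open>?N\<close> with \<open>r\<close> letters to the left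
    of the centre \<open>x\<close>.\<close>
  define M where "M = (\<lambda>t x r. suf r t @ x # take (?N - 1 - r) X)"
  have M: "w = M t x (length y)"
    if "w = y @ x # z" "suffix y t" "prefix z X" "length w = ?N" for w y x z t
  proof -
    have "length z = ?N - 1 - length y" using that by auto
    then show ?thesis
      using that suffix_eq_suf[of y t] prefix_eq_take[of z X] unfolding M_def by metis
  qed
  \<comment> \<open>The last two ranges start at 1 because the window with nothing left of the
    centre already occurs around \<open>X\<close>. The third stops at \<open>fib (k - 2)\<close>, as
    later windows recur in \<open>X @ a # X @ (\<not> a) # X\<close>.\<close>
  define U where "U = (\<lambda>(x, r). M X x r) ` (UNIV \<times> {..<?N}) \<union>
    M (pref (k + 1)) b ` {1..<?N} \<union> M (pref (k + 1)) (\<not> b) ` {1..<fib (k - 2)}"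
  have not_X: "\<not> sublist w X" if "length w = ?N" for w
    using sublist_length_le[of w X] that lX pos by auto
  have U1: "w \<in> U" if "sublist w (X @ x # X)" and l: "length w = ?N" for w x
    using that(1)
  proof (cases rule: sublist_cross)
    case (3 y z)
    then have "w = M X x (length y)" "length y < ?N" using M l by auto
    then show ?thesis by (auto simp: U_def)
  qed (use not_X l in auto)
  \<comment> \<open>At the second separator the left context again ends in \<open>X\<close>, so
    windows there are windows of some \<open>X @ x # X\<close>.\<close>
  have U2: "w \<in> U" if "sublist w (X @ a # X @ (\<not> a) # X)" and l: "length w = ?N" for w
  proof -
    have "sublist w ((X @ a # X) @ (\<not> a) # X)" using that(1) by simp
    then show ?thesis
    proof (cases rule: sublist_cross)
      case 1
      then show ?thesis using U1 l by simp
    next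
      case 2
      then show ?thesis using not_X l by simp
    next
      case (3 y z)
      have "suffix X (X @ a # X)" by (simp add: suffix_def)
      then have "suffix y X"
        using 3 l lX by (intro suffix_length_suffix[of y "X @ a # X" X]) auto
      then show ?thesis using U1[OF sublist_crossI[OF 3(1)]] 3(3) l by simp
    qed
  qed
  have U3: "w \<in> U" if "sublist w (pref (k + 1) @ x # X)" and l: "length w = ?N" for w x
    using that(1)
  proof (cases rule: sublist_cross)
    case 1
    moreover have "sublist (pref (k + 1)) (X @ a # X)"
      unfolding T using ZX by (intro prefix_imp_sublist) simp
    ultimately show ?thesis using U1[OF _ l] sublist_order.order_trans by blast
  next
    case 2
    then show ?thesis using not_X l by simp
  next
    case (3 y z)
    then have wM: "w = M (pref (k + 1)) x (length y)" "length y < ?N" using M l by auto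
    consider "length y = 0" | "x = b" "1 \<le> length y" | "x = (\<not> b)" "1 \<le> length y" "length y < fib (k - 2)"
      | "x = (\<not> b)" "fib (k - 2) \<le> length y" by (cases "x = b"; cases "length y"; force)
    then show ?thesis
    proof cases
      case 1
      then have "suffix y X" by simp
      then show ?thesis using U1[OF sublist_crossI[OF 3(1)]] 3(3) l by simp
    next
      case 2
      then show ?thesis using wM by (auto simp: U_def)
    next
      case 3
      then show ?thesis using wM by (auto simp: U_def)
    next
      case 4
      \<comment> \<open>With this many letters on the left, \<open>z\<close> fits into
        \<open>Z\<close>. Regrouping \<open>Z @ (\<not> b) # Z\<close> by the recursion yields
        \<open>X\<close> followed by \<open>\<not> a\<close>.\<close>
      have "length y + length z + 1 = ?N" using 3(1) l by simp
      then have "length z \<le> length Z" using 4(2) fk lZ by linarith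
      then have "prefix z Z" using prefix_length_prefix[OF 3(3) ZX] by simp
      then have "sublist w (pref (k + 1) @ x # Z)" by (rule sublist_crossI[OF 3(1,2)])
      also have "pref (k + 1) @ x # Z = X @ a # (Z @ (\<not> b) # pref (k - 2)) @ (\<not> a) # pref (k - 3)"
        unfolding T 4(1) by (subst (2) Z) simp
      also have "\<dots> = X @ a # X @ (\<not> a) # pref (k - 3)" unfolding X[symmetric] by simp
      also have "sublist \<dots> (X @ a # X @ (\<not> a) # X)"
        using prefix_pref[of "k - 3" k] by (auto simp: X_def prefix_def intro!: prefix_imp_sublist)
      finally show ?thesis using U2 l by simp
    qed
  qed
  have "factors dftm ?N \<subseteq> U"
  proof
    fix w assume "w \<in> factors dftm ?N"
    then have w: "w \<in> lang" "length w = ?N" by (auto simp: factors_dftm)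
    then show "w \<in> U" using lang_window[of k w] k U1 U3 by (auto simp: X_def)
  qed
  moreover have "finite U" by (simp add: U_def)
  ultimately have "card (factors dftm ?N) \<le> card U" by (rule card_mono[rotated])
  also have "card U \<le> card ((\<lambda>(x, r). M X x r) ` (UNIV \<times> {..<?N})) + card (M (pref (k + 1)) b ` {1..<?N})
      + card (M (pref (k + 1)) (\<not> b) ` {1..<fib (k - 2)})"
    unfolding U_def by (meson add_mono card_Un_le le_refl le_trans)
  also have "\<dots> \<le> card ((UNIV :: bool set) \<times> {..<?N}) + card {1..<?N} + card {1..<fib (k - 2)}"
    by (intro add_mono card_image_le) auto
  also have "\<dots> = 2 * ?N + (?N - 1) + (fib (k - 2) - 1)" by (simp add: card_cartesian_product)
  finally show ?thesis using pos by linarith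
qed

section \<open>Matching the two bounds\<close>

text \<open>Base case of the lower bound at \<open>fib 5 = 5\<close>. The listed starts are those up
  to 19 whose window has not occurred earlier in \<open>pref 9\<close>.\<close>

lemma card_factors_5_ge: "15 \<le> card (factors dftm 5)"
proof -
  have p12: "pref 1 = []" "pref 2 = []" by (simp_all add: pref_def numeral_2_eq_2 fib.simps(3))
  have g: "\<not> gap 4" "gap 5" "gap 6" "\<not> gap 7" "\<not> gap 8"
    using gap_2 gap_3 gap_rec[of 2] gap_rec[of 3] gap_rec[of 4] gap_rec[of 5] gap_rec[of 6] by auto
  have p3: "pref 3 = [True]"
    using pref_rec[of 1] p12 gap_2 by (simp add: numeral_eq_Suc)
  have p4: "pref 4 = [True, False]" using pref_rec[of 2] p12 p3 gap_3 by simp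
  have p5: "pref 5 = [True, False, False, True]" using pref_rec[of 3] p3 p4 g by simp
  define w where "w = pref 9"
  have w: "w = [True, False, False, True, True, True, False, True, True, False, False, True, False, True,
    False, False, True, True, True, False, False, True, False, False, True, True, True, False, True,
    True, False, False, True]"
    using pref_rec[of 4] pref_rec[of 5] pref_rec[of 6] pref_rec[of 7] p4 p5 g by (simp add: w_def)
  let ?ws = "map (\<lambda>i. take 5 (drop i w)) [0, 1, 2, 3, 4, 5, 6, 7, 8, 9, 10, 11, 12, 16, 19]"
  have "take 5 (drop i w) \<in> lang" for i
    unfolding lang_def w_def by (auto intro!: exI[of _ 9] sublist_order.order_trans[OF sublist_take sublist_drop])
  moreover have "length (take 5 (drop i w)) = 5" if "i \<le> 19" for i
    using that by (simp add: w)
  ultimately have "take 5 (drop i w) \<in> factors dftm 5" if "i \<le> 19" for i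
    using that unfolding factors_dftm by blast
  then have "set ?ws \<subseteq> factors dftm 5"
    unfolding set_map by (intro image_subsetI) auto
  then have "card (set ?ws) \<le> card (factors dftm 5)" using finite_factors card_mono by blast
  moreover have "distinct ?ws" by (simp add: w)
  then have "card (set ?ws) = 15" using distinct_card by fastforce
  ultimately show ?thesis by simp
qed

text \<open>A single strict step would leave a surplus of 1 that survives up to
  \<open>B\<close>.\<close>

lemma telescope_tight:
  fixes r e :: "nat \<Rightarrow> nat"
  assumes step: "\<And>n. \<lbrakk>A \<le> n; n < B\<rbrakk> \<Longrightarrow> r n + e n \<le> r (Suc n)"
    and tight: "r B \<le> r A + (\<Sum>n\<in>{A..<B}. e n)" and n: "A \<le> n" "n < B"
  shows "r (Suc n) = r n + e n"
proof (rule ccontr)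
  assume neq: "r (Suc n) \<noteq> r n + e n"
  have "r A + (\<Sum>i\<in>{A..<m}. e i) + (if n < m then 1 else 0) \<le> r m" if "A \<le> m" "m \<le> B" for m
    using that
  proof (induction m rule: dec_induct)
    case (step m)
    then show ?case using assms(1)[of m] neq n by (cases "m = n") auto
  qed (use n in simp)
  from this[of B] show False using tight n by auto
qed

text \<open>
  The lengths at which the suffixes of both \<open>branch (k - 1)\<close> and \<open>branch k\<close> are available.
\<close>

definition plateau :: "nat \<Rightarrow> nat set" where
  "plateau k = (if even k then {fib k..<2 * fib (k - 1)} else {fib k + 1..<2 * fib (k - 1) + 1})"

text \<open>When \<open>k\<close> is odd and \<open>n = fib k\<close>, the missing suffix of
  \<open>branch k\<close> is made up for by that of \<open>branch (k - 1)\<close>.\<close>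

lemma card_rspecial_ge_plateau:
  assumes "5 \<le> k" "fib k \<le> n" "n < fib (k + 1)"
  shows "3 + (if n \<in> plateau k then 1 else 0) \<le> card (rspecial n)"
proof -
  have f: "fib k = fib (k - 1) + fib (k - 2)" "fib (k - 2) \<le> fib (k - 1)"
    using fib.simps(3)[of "k - 2"] assms(1) by (simp_all add: numeral_eq_Suc Suc_diff_Suc fib_mono)
  have lb: "length (branch (k - 1)) = (if odd k then 2 * fib (k - 1) else 2 * fib (k - 1) - 1)"
    using length_branch[of "k - 1"] assms(1) by simp
  have 1: "n \<le> length (branch (k - 1))" "even k \<or> fib k < n" if "n \<in> plateau k"
    using that unfolding lb plateau_def by (auto split: if_splits)
  have 2: "n \<le> length (branch (k - 1))" if "\<not> (even k \<or> fib k < n)"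
  proof -
    have "n \<le> 2 * fib (k - 1)" using that f by linarith
    then show ?thesis using that lb by simp
  qed
  show ?thesis
  proof (cases "n \<in> plateau k")
    case True
    then show ?thesis using card_rspecial_ge[OF assms] 1 by simp
  next
    case False
    then show ?thesis
      using card_rspecial_ge[OF assms] 2 by (cases "even k \<or> fib k < n") auto
  qed
qed

text \<open>The interval has \<open>fib (k - 1)\<close> lengths and the plateau
  \<open>2 * fib (k - 1) - fib k = fib (k - 3)\<close>. The total is the increase of
  \<open>3 * fib k + fib (k - 2)\<close> from \<open>k\<close> to \<open>k + 1\<close>.\<close>

lemma sum_plateau:
  assumes "5 \<le> k"
  shows "(\<Sum>n\<in>{fib k..<fib (k + 1)}. 3 + (if n \<in> plateau k then 1 else 0 :: nat))
    = 3 * fib (k - 1) + fib (k - 3)"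
proof -
  have f: "fib (k + 1) = fib k + fib (k - 1)" "fib k = fib (k - 1) + fib (k - 2)"
    "fib (k - 1) = fib (k - 2) + fib (k - 3)" "0 < fib (k - 3)" "0 < fib (k - 2)"
    using fib.simps(3)[of "k - 1"] fib.simps(3)[of "k - 2"] fib.simps(3)[of "k - 3"] assms
    by (simp_all add: numeral_eq_Suc Suc_diff_Suc fib_neq_0_nat)
  have "{fib k..<fib (k + 1)} \<inter> plateau k = plateau k"
  proof -
    have "2 * fib (k - 1) + 1 \<le> fib (k + 1)" using f by linarith
    then show ?thesis by (auto simp: plateau_def)
  qed
  moreover have "card (plateau k) = fib (k - 3)"
  proof -
    have "2 * fib (k - 1) - fib k = fib (k - 3)" using f by linarith
    then show ?thesis by (simp add: plateau_def)
  qed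
  moreover have "(\<Sum>n\<in>{fib k..<fib (k + 1)}. if n \<in> plateau k then 1 else 0 :: nat)
      = card ({fib k..<fib (k + 1)} \<inter> plateau k)"
    using sum.inter_restrict[of "{fib k..<fib (k + 1)}" "\<lambda>_. 1 :: nat" "plateau k"] by simp
  ultimately show ?thesis using f(1) by (simp add: sum.distrib)
qed

lemma card_factors_fib:
  assumes "5 \<le> k"
  shows "card (factors dftm (fib k)) + 2 = 3 * fib k + fib (k - 2)"
proof -
  have "3 * fib k + fib (k - 2) \<le> card (factors dftm (fib k)) + 2"
    using assms
  proof (induction k rule: dec_induct)
    case base
    then show ?case using card_factors_5_ge by (simp add: numeral_eq_Suc fib.simps(3))
  next
    case (step k)
    let ?e = "\<lambda>n. 3 + (if n \<in> plateau k then 1 else 0 :: nat)"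
    have "card (factors dftm (fib k)) + (\<Sum>n\<in>{fib k..<m}. ?e n) \<le> card (factors dftm m)"
      if "fib k \<le> m" "m \<le> fib (k + 1)" for m
      using that
    proof (induction m rule: dec_induct)
      case (step m)
      then show ?case
        using card_factors_Suc_ge[of m] card_rspecial_ge_plateau[of k m] \<open>5 \<le> k\<close> by simp
    qed simp
    from this[of "fib (k + 1)"] have "card (factors dftm (fib k)) + (3 * fib (k - 1) + fib (k - 3))
        \<le> card (factors dftm (fib (k + 1)))"
      using sum_plateau[of k] \<open>5 \<le> k\<close> fib_mono[of k "k + 1"] by simp
    moreover have "fib (k + 1) = fib k + fib (k - 1)" "fib (k - 1) = fib (k - 2) + fib (k - 3)"
      using fib.simps(3)[of "k - 1"] fib.simps(3)[of "k - 3"] \<open>5 \<le> k\<close>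
      by (simp_all add: numeral_eq_Suc Suc_diff_Suc)
    ultimately have "3 * fib (k + 1) + fib (k - 1) \<le> card (factors dftm (fib (k + 1))) + 2"
      using step.IH by linarith
    then show ?case by (simp add: numeral_2_eq_2)
  qed
  moreover have "card (factors dftm (fib k)) + 2 \<le> 3 * fib k + fib (k - 2)"
    using assms by (intro card_factors_fib_le) simp
  ultimately show ?thesis by (rule antisym[rotated])
qed

lemma card_factors_Suc:
  assumes k: "5 \<le> k" and n: "fib k \<le> n" "n < fib (k + 1)"
  shows "card (factors dftm (Suc n)) = card (factors dftm n) + (if n \<in> plateau k then 4 else 3)"
proof -
  let ?e = "\<lambda>n. 3 + (if n \<in> plateau k then 1 else 0 :: nat)"
  have "card (factors dftm (Suc n)) = card (factors dftm n) + ?e n"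
  proof (rule telescope_tight[OF _ _ n])
    show "card (factors dftm n) + ?e n \<le> card (factors dftm (Suc n))" if "fib k \<le> n" "n < fib (k + 1)" for n
      using card_factors_Suc_ge[of n] card_rspecial_ge_plateau[OF k that] by linarith
    have "fib (k + 1) = fib k + fib (k - 1)" "fib (k - 1) = fib (k - 2) + fib (k - 3)"
      using fib.simps(3)[of "k - 1"] fib.simps(3)[of "k - 3"] k
      by (simp_all add: numeral_eq_Suc Suc_diff_Suc)
    moreover have "card (factors dftm (fib (k + 1))) + 2 = 3 * fib (k + 1) + fib (k - 1)"
      using card_factors_fib[of "k + 1"] k by (simp add: numeral_2_eq_2)
    ultimately show "card (factors dftm (fib (k + 1))) \<le>
        card (factors dftm (fib k)) + (\<Sum>n\<in>{fib k..<fib (k + 1)}. ?e n)"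
      using card_factors_fib[OF k] unfolding sum_plateau[OF k] by linarith
  qed
  then show ?thesis by simp
qed

text \<open>Complementation doubles the increments 4 and 3; taking changes shortens words by one,
  hence \<open>n - 1\<close>.\<close>

lemma ftm_d_eq:
  assumes "5 \<le> k" "fib k < n" "n \<le> fib (k + 1)"
  shows "ftm_d n = (if n - 1 \<in> plateau k then 8 else 6)"
  using ftm_d_Suc[of "n - 1"] card_factors_Suc[of k "n - 1"] assms by auto

theorem theorem2:
  fixes m :: nat
  assumes "m \<ge> 2"
  shows "(\<forall>n. fib (2*m+1) + 2 \<le> n \<and> n \<le> fib (2*m+1) + fib (2*m-2) + 1 \<longrightarrow> ftm_d n = 8) \<and>
         (\<forall>n. fib (2*m+1) + fib (2*m-2) + 2 \<le> n \<and> n \<le> fib (2*m+2) \<longrightarrow> ftm_d n = 6) \<and>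
         (\<forall>n. fib (2*m+2) + 1 \<le> n \<and> n \<le> fib (2*m+2) + fib (2*m-1) \<longrightarrow> ftm_d n = 8) \<and>
         (\<forall>n. fib (2*m+2) + fib (2*m-1) + 1 \<le> n \<and> n \<le> fib (2*m+3) + 1 \<longrightarrow> ftm_d n = 6)"
proof -
  define c where "c = 2 * m - 2"
  have c: "2 * m = c + 2" "even c" "2 \<le> c" using assms by (auto simp: c_def)
  \<comment> \<open>All Fibonacci numbers involved are linear in \<open>x\<close> and
    \<open>y\<close>, which leaves linear arithmetic on the interval ends.\<close>
  define x y where "x = fib c" and "y = fib (c + 1)"
  have f: "fib (2*m-2) = x" "fib (2*m-1) = y" "fib (2*m) = x + y" "fib (2*m+1) = x + 2 * y"
    "fib (2*m+2) = 2 * x + 3 * y" "fib (2*m+3) = 3 * x + 5 * y" "fib (2*m+4) = 5 * x + 8 * y"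
    unfolding c x_def y_def by (simp_all add: numeral_eq_Suc fib.simps(3))
  have pos: "0 < x" "0 < y" using c by (auto simp: x_def y_def intro: fib_neq_0_nat)
  have "plateau (2*m+1) = {x + 2 * y + 1..<2 * x + 2 * y + 1}"
    by (simp add: plateau_def f(3) f(4)[simplified])
  then have 1: "ftm_d n = (if n - 1 \<in> {x + 2 * y + 1..<2 * x + 2 * y + 1} then 8 else 6)"
    if "x + 2 * y < n" "n \<le> 2 * x + 3 * y" for n
    using ftm_d_eq[of "2*m+1" n] that assms f by (simp add: numeral_eq_Suc)
  have "plateau (2*m+2) = {2 * x + 3 * y..<2 * x + 4 * y}"
    using f(4,5) by (simp add: plateau_def)
  then have 2: "ftm_d n = (if n - 1 \<in> {2 * x + 3 * y..<2 * x + 4 * y} then 8 else 6)"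
    if "2 * x + 3 * y < n" "n \<le> 3 * x + 5 * y" for n
    using ftm_d_eq[of "2*m+2" n] that assms f by (simp add: numeral_eq_Suc)
  \<comment> \<open>The final length already belongs to the block of \<open>2*m+3\<close>, whose
    plateau, the index being odd, starts one later.\<close>
  have "3 * x + 5 * y \<notin> plateau (2*m+3)"
    using f(6) by (simp add: plateau_def)
  then have 3: "ftm_d (3 * x + 5 * y + 1) = 6"
    using ftm_d_eq[of "2*m+3" "3 * x + 5 * y + 1"] assms f pos by (simp add: numeral_eq_Suc)
  show ?thesis
    unfolding f
  proof (intro conjI allI impI; elim conjE)
    fix n assume "x + 2 * y + 2 \<le> n" "n \<le> x + 2 * y + x + 1"
    then show "ftm_d n = 8" using 1[of n] pos by auto
  next
    fix n assume "x + 2 * y + x + 2 \<le> n" "n \<le> 2 * x + 3 * y"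
    then show "ftm_d n = 6" using 1[of n] by auto
  next
    fix n assume "2 * x + 3 * y + 1 \<le> n" "n \<le> 2 * x + 3 * y + y"
    then show "ftm_d n = 8" using 2[of n] pos by auto
  next
    fix n assume "2 * x + 3 * y + y + 1 \<le> n" "n \<le> 3 * x + 5 * y + 1"
    then show "ftm_d n = 6" using 2[of n] 3 by (cases "n = 3 * x + 5 * y + 1") auto
  qed
qed

end
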